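(* Let $d>0$ be a squarefree integer, $K=\mathbb{Q}(\sqrt{-d})$, and $S$ a finite set of rational primes. Then $K$ is $S$-norm-Euclidean for each of the following choices of $S$ and $d$: (i) $S=\emptyset$: $d\in\{1,2,3,7,11\}$; (ii) $S=\{2\}$: $d\in\{1,2,3,5,6,7,11,15,19,23\}$; (iii) $S=\{2,3\}$: $d\in\{1,2,3,5,6,7,10,11,13,14,15,17,19,23,31,35,39,43,47,51,55,59,67,71\}$; (iv) $S=\{2,3,5\}$: $d\in\{1,2,3,5,6,7,10,11,13,14,15,17,19,21,22,23,26,29,30,31,33,34,35,39,43,47,51,55,59,67,71,79,83,87,91,95,103,107,111,115,119,123,127,131,139,143\}$.
   Context: For squarefree $d>0$, $K=\mathbb{Q}(\sqrt{-d})=\{x+y\sqrt{-d}: x,y\in\mathbb{Q}\}\subseteq\mathbb{C}$. Put $w=\sqrt{-d}$ if $-d\equiv 2,3\pmod 4$ and $w=(1+\sqrt{-d})/2$ if $-d\equiv 1\pmod 4$; the ring of integers is $\mathcal{O}=\mathbb{Z}[w]=\{a+bw: a,b\in\mathbb{Z}\}$. The norm is $N(x+y\sqrt{-d})=x^2+dy^2$. For a finite set $S$ of rational primes, let $T$ be the set of positive integers all of whose prime factors lie in $S$ (so $1\in T$), and $\mathcal{O}_S=\{(a+bw)/c: a,b\in\mathbb{Z}, c\in T\}$. For nonzero $\xi\in K$, the $S$-norm $N_S(\xi)$ is the positive rational number obtained from $N(\xi)$ by deleting all primes of $S$ from the prime factorizations of its numerator and denominator; $N_S(0)=0$. $K$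 is called $S$-norm-Euclidean if for every $\xi\in K$ there exists $\gamma\in\mathcal{O}_S$ with $N_S(\xi-\gamma)<1$. *)

theory Defs
  imports Complex_Main "HOL-Number_Theory.Cong" "HOL-Computational_Algebra.Squarefree"
begin

definition sqrt_neg :: "nat \<Rightarrow> complex" where
  "sqrt_neg d = \<i> * complex_of_real (sqrt (real d))"

definition quad_field :: "nat \<Rightarrow> complex set" where
  "quad_field d = {of_rat x + of_rat y * sqrt_neg d | x y :: rat. True}"

definition int_gen :: "nat \<Rightarrow> complex" where
  "int_gen d = (if [- int d = 1] (mod 4) then (1 + sqrt_neg d) / 2 else sqrt_neg d)"

text \<open>The description is proper for \<open>d > 0\<close> and \<open>\<xi>\<close> in \<^term>\<open>quad_field d\<close>:
  see \<open>quad_norm_eq\<close> below.\<close>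

definition quad_norm :: "nat \<Rightarrow> complex \<Rightarrow> rat" where
  "quad_norm d \<xi> =
     (THE q. \<exists>x y :: rat. \<xi> = of_rat x + of_rat y * sqrt_neg d \<and> q = x\<^sup>2 + of_nat d * y\<^sup>2)"

definition S_smooth :: "nat set \<Rightarrow> nat set" where
  "S_smooth S = {n. n > 0 \<and> (\<forall>p. prime p \<and> p dvd n \<longrightarrow> p \<in> S)}"

definition S_integers :: "nat set \<Rightarrow> nat \<Rightarrow> complex set" where
  "S_integers S d =
     {(of_int a + of_int b * int_gen d) / of_nat c | (a :: int) (b :: int) c. c \<in> S_smooth S}"

definition delete_primes :: "nat set \<Rightarrow> nat \<Rightarrow> nat" where
  "delete_primes S n = (\<Prod>p \<in> prime_factors n - S. p ^ multiplicity p n)"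

text \<open>\<^const>\<open>quotient_of\<close> returns numerator and denominator in lowest terms, the denominator
  being positive; only positive rationals are relevant here.\<close>

definition delete_primes_rat :: "nat set \<Rightarrow> rat \<Rightarrow> rat" where
  "delete_primes_rat S r =
     of_nat (delete_primes S (nat (fst (quotient_of r)))) /
     of_nat (delete_primes S (nat (snd (quotient_of r))))"

definition S_norm :: "nat set \<Rightarrow> nat \<Rightarrow> complex \<Rightarrow> rat" where
  "S_norm S d \<xi> = (if \<xi> = 0 then 0 else delete_primes_rat S (quad_norm d \<xi>))"

definition S_norm_Euclidean :: "nat set \<Rightarrow> nat \<Rightarrow> bool" where
  "S_norm_Euclidean S d \<longleftrightarrow>
     (\<forall>\<xi> \<in> quad_field d. \<exists>\<gamma> \<in> S_integers S d. S_norm S d (\<xi> - \<gamma>) < 1)"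

lemma quad_field_coords_unique:
  fixes x y x' y' :: rat
  assumes "d > 0" and "of_rat x + of_rat y * sqrt_neg d = of_rat x' + of_rat y' * sqrt_neg d"
  shows "x = x' \<and> y = y'"
proof -
  have r: "of_rat q = complex_of_real (of_rat q)" for q :: rat
    by (cases q) (simp add: of_rat_rat)
  have "Re (of_rat x + of_rat y * sqrt_neg d) = Re (of_rat x' + of_rat y' * sqrt_neg d)"
    and "Im (of_rat x + of_rat y * sqrt_neg d) = Im (of_rat x' + of_rat y' * sqrt_neg d)"
    using assms(2) by simp_all
  then show ?thesis
    using assms(1) by (simp add: r sqrt_neg_def)
qed

lemma quad_norm_eq:
  assumes "d > 0"
  shows "quad_norm d (of_rat x + of_rat y * sqrt_neg d) = x\<^sup>2 + of_nat d * y\<^sup>2"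
  unfolding quad_norm_def
proof (rule the_equality)
  show "\<exists>x' y'. of_rat x + of_rat y * sqrt_neg d = of_rat x' + of_rat y' * sqrt_neg d \<and>
          x\<^sup>2 + of_nat d * y\<^sup>2 = x'\<^sup>2 + of_nat d * y'\<^sup>2"
    by blast
next
  fix q
  assume "\<exists>x' y'. of_rat x + of_rat y * sqrt_neg d = of_rat x' + of_rat y' * sqrt_neg d \<and>
            q = x'\<^sup>2 + of_nat d * y'\<^sup>2"
  then show "q = x\<^sup>2 + of_nat d * y\<^sup>2"
    using quad_field_coords_unique[OF assms] by blast
qed

end

theory Submission
  imports Defs
begin

text \<open>After multiplication by an element of \<^term>\<open>S_smooth S\<close>, the denominator \<open>m\<close> of \<open>\<xi>\<close>
  is prime to \<open>S\<close>; then \<open>N_S(\<xi> - \<gamma>) \<le> N(\<xi> - \<gamma>)\<close> for every algebraic integer \<open>\<gamma>\<close>, because the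
  primes of \<open>S\<close> are deleted from the numerator only.  If \<open>1, \<dots>, n\<close> all lie in
  \<^term>\<open>S_smooth S\<close>, the sharp form of Dirichlet's approximation theorem gives \<open>k \<le> n\<close> such that the
  \<open>w\<close>-coordinate of \<open>k * \<xi>\<close> is within \<open>1 / (n + 1)\<close> of an integer.  The real part can be moved to
  \<open>[-1/2, 1/2]\<close>, so a remainder of norm at most \<open>1/4 + (Im w)\<^sup>2 / (n + 1)\<^sup>2\<close> is reached, and
  this is less than 1 when \<open>4 * d < 3 * (n + 1)\<^sup>2\<close> for \<open>w = \<surd>-d\<close>, and when \<open>d < 3 * (n + 1)\<^sup>2\<close> for
  \<open>w = (1 + \<surd>-d) / 2\<close>.  The four choices of \<open>S\<close> have \<open>n = 1, 2, 4, 6\<close>.\<close>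

subsection \<open>Dirichlet approximation\<close>

text \<open>Cut [0, 1) into n + 1 cells of length 1 / (n + 1). Either the fractional part of some k
  * u lies in the first or the last cell, next to an integer, or n points share the n - 1 inner
  cells and two of them collide.\<close>

lemma dirichlet_approx_sharp:
  fixes u :: "'a :: floor_ceiling"
  assumes "n > 0"
  obtains k :: nat and b :: int
    where "k \<in> {1..n}" and "\<bar>of_nat k * u - of_int b\<bar> \<le> 1 / of_nat (n + 1)"
proof -
  define f where "f k = \<lfloor>of_nat (n + 1) * frac (of_nat k * u)\<rfloor>" for k
  have pos: "(0 :: 'a) < of_nat (n + 1)"
    by (simp only: of_nat_0_less_iff)
  have f_le: "of_int (f k) \<le> of_nat (n + 1) * frac (of_nat k * u)"
    and f_gt: "of_nat (n + 1) * frac (of_nat k * u) < of_int (f k) + 1" for k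
    unfolding f_def by linarith+
  have f_range: "f k \<in> {0..int n}" for k
  proof -
    have "of_nat (n + 1) * frac (of_nat k * u) < of_nat (n + 1) * 1"
      using frac_lt_1[of "of_nat k * u"] pos by (intro mult_strict_left_mono) auto
    then have "f k < int (n + 1)"
      unfolding f_def floor_less_iff by simp
    moreover have "f k \<ge> 0"
      unfolding f_def by (simp add: frac_ge_0)
    ultimately show ?thesis by simp
  qed
  have close: "\<bar>v\<bar> \<le> 1 / of_nat (n + 1)" if "\<bar>of_nat (n + 1) * v\<bar> \<le> 1" for v :: 'a
  proof -
    have "of_nat (n + 1) * \<bar>v\<bar> \<le> 1"
      using that by (simp only: abs_mult abs_of_nat)
    then show ?thesis
      using pos by (simp only: pos_le_divide_eq mult.commute)
  qed
  show ?thesis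
  proof (cases "\<exists>k\<in>{1..n}. f k = 0 \<or> f k = int n")
    case True
    then obtain k where k: "k \<in> {1..n}" and "f k = 0 \<or> f k = int n" by blast
    then consider "f k = 0" | "f k = int n" by blast
    then show ?thesis
    proof cases
      case 1
      have "\<bar>frac (of_nat k * u)\<bar> \<le> 1 / of_nat (n + 1)"
        using f_le[of k] f_gt[of k] unfolding 1 by (intro close) simp
      then show ?thesis
        using that[OF k, of "\<lfloor>of_nat k * u\<rfloor>"] by (simp add: frac_def)
    next
      case 2
      \<comment> \<open>In the last cell the fractional part is close to 1, so the integer
        approximated is the floor plus 1.\<close>
      have "\<bar>of_nat (n + 1) * (frac (of_nat k * u) - 1)\<bar> \<le> 1"
        using f_le[of k] f_gt[of k] unfolding 2 by (simp add: algebra_simps)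
      then have "\<bar>frac (of_nat k * u) - 1\<bar> \<le> 1 / of_nat (n + 1)"
        by (rule close)
      then show ?thesis
        using that[OF k, of "\<lfloor>of_nat k * u\<rfloor> + 1"] by (simp add: frac_def algebra_simps)
    qed
  next
    case False
    have "f k \<in> {1..int n - 1}" if "k \<in> {1..n}" for k
    proof -
      have "f k \<noteq> 0" "f k \<noteq> int n"
        using False that by blast+
      then show ?thesis
        using f_range[of k] by simp
    qed
    \<comment> \<open>There are n indices for n - 1 inner cells; for n = 1 the inner range is empty,
      which is already a contradiction.\<close>
    then have "f ` {1..n} \<subseteq> {1..int n - 1}"
      by blast
    then have "card (f ` {1..n}) \<le> card {1..int n - 1}"
      by (intro card_mono) auto
    also have "\<dots> < card {1..n}"
      using assms by simp
    finally have "\<not> inj_on f {1..n}"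
      by (rule pigeonhole)
    then obtain i j where "i \<in> {1..n}" "j \<in> {1..n}" "f i = f j" "i < j"
      unfolding inj_on_def by (metis nat_neq_iff)
    note ij = this
    \<comment> \<open>Two points of one cell differ by less than its length, so j - i serves as the
      multiplier.\<close>
    have "\<bar>of_nat (n + 1) * (frac (of_nat j * u) - frac (of_nat i * u))\<bar> \<le> 1"
      using f_le[of i] f_gt[of i] f_le[of j] f_gt[of j] unfolding \<open>f i = f j\<close>
      by (simp add: algebra_simps abs_le_iff)
    then have "\<bar>frac (of_nat j * u) - frac (of_nat i * u)\<bar> \<le> 1 / of_nat (n + 1)"
      by (rule close)
    moreover have "frac (of_nat j * u) - frac (of_nat i * u) =
        of_nat (j - i) * u - of_int (\<lfloor>of_nat j * u\<rfloor> - \<lfloor>of_nat i * u\<rfloor>)"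
      using ij by (simp add: frac_def of_nat_diff algebra_simps)
    moreover have "j - i \<in> {1..n}"
      using ij by auto
    ultimately show ?thesis
      using that by metis
  qed
qed

subsection \<open>Deleting primes\<close>

lemma delete_primes_eq_prod:
  assumes "finite A" "prime_factors n - S \<subseteq> A" "\<forall>p\<in>A. prime p \<and> p \<notin> S"
  shows "delete_primes S n = (\<Prod>p\<in>A. p ^ multiplicity p n)"
  unfolding delete_primes_def
proof (rule prod.mono_neutral_left)
  show "\<forall>p\<in>A - (prime_factors n - S). p ^ multiplicity p n = 1"
    using assms(3) by (auto simp: prime_factors_multiplicity)
qed (use assms in auto)

lemma delete_primes_mult:
  assumes "m > 0" "n > 0"
  shows "delete_primes S (m * n) = delete_primes S m * delete_primes S n"
proof -
  define A where "A = prime_factors (m * n) - S"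
  have A: "finite A" "\<forall>p\<in>A. prime p \<and> p \<notin> S" "prime_factors (m * n) - S \<subseteq> A"
      "prime_factors m - S \<subseteq> A" "prime_factors n - S \<subseteq> A"
    using assms unfolding A_def by (auto simp: prime_factors_product)
  have "delete_primes S (m * n) = (\<Prod>p\<in>A. p ^ (multiplicity p m + multiplicity p n))"
    unfolding delete_primes_eq_prod[OF A(1,3,2)]
    using A(2) assms by (intro prod.cong) (auto simp: prime_elem_multiplicity_mult_distrib)
  also have "\<dots> = delete_primes S m * delete_primes S n"
    unfolding delete_primes_eq_prod[OF A(1,4,2)] delete_primes_eq_prod[OF A(1,5,2)]
    by (simp add: power_add prod.distrib)
  finally show ?thesis .
qed

lemma delete_primes_pos: "delete_primes S n > 0"
  unfolding delete_primes_def by (intro prod_pos) (auto simp: in_prime_factors_iff prime_gt_0_nat)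

lemma delete_primes_smooth:
  assumes "n \<in> S_smooth S"
  shows "delete_primes S n = 1"
proof -
  have "prime_factors n - S = {}"
    using assms by (auto simp: S_smooth_def in_prime_factors_iff)
  then show ?thesis
    by (simp only: delete_primes_def prod.empty)
qed

lemma smooth_part:
  assumes "n > 0"
  obtains t where "t \<in> S_smooth S" "n = t * delete_primes S n"
proof
  define t where "t = (\<Prod>p\<in>prime_factors n \<inter> S. p ^ multiplicity p n)"
  have "prime_factors n = (prime_factors n \<inter> S) \<union> (prime_factors n - S)"
    by blast
  then have "n = (\<Prod>p\<in>(prime_factors n \<inter> S) \<union> (prime_factors n - S). p ^ multiplicity p n)"
    using assms prod_prime_factors[of n] by simp
  also have "\<dots> = t * delete_primes S n"
    unfolding t_def delete_primes_def by (subst prod.union_disjoint) auto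
  finally show "n = t * delete_primes S n" .
  show "t \<in> S_smooth S"
    unfolding S_smooth_def
  proof (intro CollectI conjI allI impI)
    show "t > 0"
      unfolding t_def by (intro prod_pos) (auto simp: in_prime_factors_iff prime_gt_0_nat)
    fix p :: nat
    assume p: "prime p \<and> p dvd t"
    then obtain q where q: "q \<in> prime_factors n \<inter> S" "p dvd q ^ multiplicity q n"
      unfolding t_def by (auto simp: prime_dvd_prod_iff)
    then have "p dvd q"
      using p prime_dvd_power by blast
    then have "p = q"
      using p q by (auto simp: in_prime_factors_iff primes_dvd_imp_eq)
    then show "p \<in> S"
      using q by simp
  qed
qed

lemma delete_primes_le:
  assumes "n > 0"
  shows "delete_primes S n \<le> n"
proof -
  obtain t where t: "t \<in> S_smooth S" "n = t * delete_primes S n"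
    using assms by (rule smooth_part)
  then have "1 \<le> t"
    by (simp add: S_smooth_def)
  then have "1 * delete_primes S n \<le> t * delete_primes S n"
    by (rule mult_right_mono) simp
  then show ?thesis
    using t(2) by simp
qed

lemma S_smooth_mult:
  assumes "m \<in> S_smooth S" "n \<in> S_smooth S"
  shows "m * n \<in> S_smooth S"
  using assms by (auto simp: S_smooth_def prime_dvd_mult_iff)

text \<open>Cross-multiplying with the reduced fraction and using multiplicativity of
  \<open>delete_primes\<close> shows that lowest terms do not matter, so S-norms can be read off
  from any positive fraction.\<close>

lemma delete_primes_rat_of_nat_divide:
  assumes "a > 0" "b > 0"
  shows "delete_primes_rat S (of_nat a / of_nat b) =
    of_nat (delete_primes S a) / of_nat (delete_primes S b)"
proof -
  define r :: rat where "r = of_nat a / of_nat b"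
  obtain p q where pq: "quotient_of r = (p, q)"
    by fastforce
  have "q > 0"
    using quotient_of_denom_pos[OF pq] .
  moreover have r: "r = of_int p / of_int q"
    using quotient_of_div[OF pq] .
  moreover have "r > 0"
    using assms by (simp add: r_def)
  ultimately have "p > 0"
    by (simp add: zero_less_divide_iff)
  have "rat_of_nat (a * nat q) = of_nat (nat p * b)"
    using r assms \<open>p > 0\<close> \<open>q > 0\<close> unfolding r_def by (simp add: field_simps)
  then have "a * nat q = nat p * b"
    by (simp only: of_nat_eq_iff)
  then have "delete_primes S a * delete_primes S (nat q) = delete_primes S (nat p) * delete_primes S b"
    using assms \<open>p > 0\<close> \<open>q > 0\<close> by (simp flip: delete_primes_mult)
  then have "rat_of_nat (delete_primes S a) * of_nat (delete_primes S (nat q)) =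
      of_nat (delete_primes S (nat p)) * of_nat (delete_primes S b)"
    by (simp only: flip: of_nat_mult)
  then have "delete_primes_rat S r = of_nat (delete_primes S a) / of_nat (delete_primes S b)"
    using delete_primes_pos[of S b] delete_primes_pos[of S "nat q"]
    unfolding delete_primes_rat_def pq by (simp add: field_simps)
  then show ?thesis
    unfolding r_def .
qed

lemma common_denominator:
  fixes x y :: rat
  obtains a b :: int and m :: nat
    where "m > 0" "x = of_int a / of_nat m" "y = of_int b / of_nat m"
proof -
  obtain p q where pq: "q > 0" "x = of_int p / of_int q"
    by (metis Fract_of_int_quotient Rat_cases)
  obtain r s where rs: "s > 0" "y = of_int r / of_int s"
    by (metis Fract_of_int_quotient Rat_cases)
  show ?thesis
    by (rule that[of "nat (q * s)" "p * s" "r * q"]) (use pq rs in \<open>auto simp: field_simps\<close>)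
qed

lemma atLeastAtMost_subset_S_smooth:
  assumes "\<And>p. prime p \<Longrightarrow> p \<le> n \<Longrightarrow> p \<in> S"
  shows "{1..n} \<subseteq> S_smooth S"
proof
  fix k assume k: "k \<in> {1..n}"
  then have "p \<le> n" if "p dvd k" for p
    using dvd_imp_le[OF that] by simp
  then show "k \<in> S_smooth S"
    using k assms unfolding S_smooth_def by simp
qed

subsection \<open>The Euclidean criterion\<close>

text \<open>The rationals \<open>g\<close> and \<open>h\<close> are the coordinates of w, so that
  both shapes of w share one argument. \<open>int_norm\<close> expresses that elements of Z[w] have
  integral norm, and \<open>bound\<close> is 1/4 + d * h^2 / (n + 1)^2 < 1 with denominators
  cleared.\<close>

lemma S_norm_Euclidean_criterion:
  fixes g h :: rat
  assumes d: "d > 0" and "n > 0"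
    and smooth: "{1..n} \<subseteq> S_smooth S"
    and gen: "int_gen d = of_rat g + of_rat h * sqrt_neg d" and "h \<noteq> 0"
    and int_norm: "\<And>p q :: int. (of_int p + of_int q * g)\<^sup>2 + of_nat d * (of_int q * h)\<^sup>2 \<in> \<int>"
    and bound: "4 * (of_nat d * h\<^sup>2) < 3 * (of_nat (n + 1))\<^sup>2"
  shows "S_norm_Euclidean S d"
  unfolding S_norm_Euclidean_def
proof
  fix \<xi> assume "\<xi> \<in> quad_field d"
  then obtain x y where \<xi>: "\<xi> = of_rat x + of_rat y * sqrt_neg d"
    unfolding quad_field_def by blast
  \<comment> \<open>In the basis 1, w the element is (A + B * w) / m.\<close>
  obtain A B :: int and m :: nat
    where m: "m > 0" and AB: "x - y / h * g = of_int A / of_nat m" "y / h = of_int B / of_nat m"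
    by (rule common_denominator)
  obtain t where t: "t \<in> S_smooth S" "m = t * delete_primes S m"
    using m by (rule smooth_part)
  define m' where "m' = delete_primes S m"
  have m': "m' > 0" "delete_primes S m' = m'" and t0: "t > 0"
  proof -
    show "m' > 0" "t > 0"
      using delete_primes_pos t by (auto simp: m'_def S_smooth_def)
    \<comment> \<open>Apply \<open>delete_primes\<close> to both sides of m = t * m': the smooth
      factor t disappears. Hence m' survives deletion intact.\<close>
    then show "delete_primes S m' = m'"
      using delete_primes_mult[of t m' S] delete_primes_smooth[OF t(1)] t(2) by (simp add: m'_def)
  qed
  obtain k b where k: "k \<in> {1..n}"
    and b: "\<bar>of_nat k * (of_int B / of_nat m') - of_int b\<bar> \<le> 1 / rat_of_nat (n + 1)"
    using \<open>n > 0\<close> by (rule dirichlet_approx_sharp)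
  \<comment> \<open>X + Y * w is the remainder k * t * \<xi> - (a + b * w). Its rational part is X +
    Y * g, so \<open>a\<close> must round with the shift Y * g included. \<open>N\<close> is the
    norm of this remainder, that is, of c * (\<xi> - \<gamma>).\<close>
  define Y where "Y = of_nat k * (of_int B / of_nat m') - rat_of_int b"
  define a where "a = round (of_nat k * (of_int A / of_nat m') + Y * g)"
  define X where "X = of_nat k * (of_int A / of_nat m') - rat_of_int a"
  define c where "c = k * t"
  define \<gamma> where "\<gamma> = (of_int a + of_int b * int_gen d) / of_nat c"
  define N where "N = (X + Y * g)\<^sup>2 + of_nat d * (Y * h)\<^sup>2"
  have c: "c \<in> S_smooth S" "c > 0"
    using k smooth t t0 by (auto simp: c_def intro!: S_smooth_mult)
  have "N < 1"
  proof -
    have "\<bar>X + Y * g\<bar> \<le> 1 / 2"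
      using of_int_round_abs_le[of "of_nat k * (of_int A / of_nat m') + Y * g"]
      by (simp add: X_def a_def abs_minus_commute algebra_simps)
    then have "(X + Y * g)\<^sup>2 \<le> (1 / 2)\<^sup>2"
      using abs_le_square_iff[of "X + Y * g" "1/2"] by simp
    moreover have "Y\<^sup>2 \<le> (1 / of_nat (n + 1))\<^sup>2"
      using b abs_le_square_iff[of Y "1 / of_nat (n + 1)"] unfolding Y_def[symmetric] by simp
    then have "of_nat d * h\<^sup>2 * Y\<^sup>2 \<le> of_nat d * h\<^sup>2 * (1 / of_nat (n + 1))\<^sup>2"
      by (intro mult_left_mono) auto
    moreover have "of_nat d * h\<^sup>2 * (1 / of_nat (n + 1))\<^sup>2 < 3 / 4"
    proof -
      have "(0::rat) < (of_nat (n + 1))\<^sup>2"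
        by (simp only: zero_less_power of_nat_0_less_iff)
      with bound show ?thesis
        by (simp only: power_one_over) (simp add: divide_simps del: of_nat_Suc)
    qed
    moreover have "N = (X + Y * g)\<^sup>2 + of_nat d * h\<^sup>2 * Y\<^sup>2"
      by (simp add: N_def power_mult_distrib mult_ac)
    moreover have "(1 / 2 :: rat)\<^sup>2 = 1 / 4"
      by (simp add: power2_eq_square)
    ultimately show ?thesis
      by linarith
  qed
  have x_eq: "x = of_int A / of_nat m + of_int B / of_nat m * g" and y_eq: "y = of_int B / of_nat m * h"
    using AB \<open>h \<noteq> 0\<close> by (auto simp: field_simps)
  have m_eq: "m = t * m'"
    using t by (simp add: m'_def)
  have diff: "\<xi> - \<gamma> = of_rat ((X + Y * g) / of_nat c) + of_rat (Y * h / of_nat c) * sqrt_neg d"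
  proof -
    have coords: "(X + Y * g) / of_nat c = x - (of_int a + of_int b * g) / of_nat c"
      "Y * h / of_nat c = y - of_int b * h / of_nat c"
      unfolding x_eq y_eq X_def Y_def m_eq c_def using m' t0 k
      by (simp_all add: field_simps)
    show ?thesis
      unfolding coords unfolding \<xi> \<gamma>_def gen
      by (simp add: of_rat_diff of_rat_divide of_rat_add of_rat_mult add_divide_distrib algebra_simps)
  qed
  have norm: "quad_norm d (\<xi> - \<gamma>) = N / (of_nat c)\<^sup>2"
    unfolding diff quad_norm_eq[OF d] N_def
    by (simp only: times_divide_eq_right power_divide) (rule add_divide_distrib[symmetric])
  have "S_norm S d (\<xi> - \<gamma>) < 1"
  proof (cases "\<xi> - \<gamma> = 0")
    case False
    \<comment> \<open>m' * (X + Y * w) = P + Q * w lies in Z[w], so N * m'^2 is an integer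
      z.\<close>
    define P Q where "P = int k * A - int m' * a" and "Q = int k * B - int m' * b"
    have PQ: "X = of_int P / of_nat m'" "Y = of_int Q / of_nat m'"
      using m' by (auto simp: X_def Y_def P_def Q_def field_simps)
    obtain z :: int where z: "(of_int P + of_int Q * g)\<^sup>2 + of_nat d * (of_int Q * h)\<^sup>2 = of_int z"
      using int_norm[of P Q] by (auto elim: Ints_cases)
    have N_eq: "N = of_int z / (of_nat m')\<^sup>2"
      unfolding N_def PQ z[symmetric] using m' by (simp add: field_simps power2_eq_square)
    \<comment> \<open>Since \<xi> and \<gamma> differ, z is strictly positive, as the deletion rule
      for fractions requires.\<close>
    have "N \<noteq> 0"
    proof
      assume "N = 0"
      then have "(X + Y * g)\<^sup>2 = 0" "of_nat d * (Y * h)\<^sup>2 = 0"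
        unfolding N_def
        by (simp_all only: add_nonneg_eq_0_iff zero_le_power2 mult_nonneg_nonneg of_nat_0_le_iff)
      then have "X + Y * g = 0" "Y * h = 0"
        using d by simp_all
      then show False
        using False unfolding diff by simp
    qed
    moreover have "N \<ge> 0"
      by (simp add: N_def)
    ultimately have "N > 0"
      by simp
    then have "z > 0"
      unfolding N_eq using m' by (simp add: zero_less_divide_iff)
    have "quad_norm d (\<xi> - \<gamma>) = of_nat (nat z) / of_nat ((m' * m') * (c * c))"
      unfolding norm N_eq using \<open>z > 0\<close> by (simp add: power2_eq_square)
    then have "S_norm S d (\<xi> - \<gamma>) =
        of_nat (delete_primes S (nat z)) / of_nat (delete_primes S ((m' * m') * (c * c)))"
      using False \<open>z > 0\<close> m' c by (simp only: S_norm_def if_False)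
        (rule delete_primes_rat_of_nat_divide; simp)
    \<comment> \<open>Deletion removes the smooth factor c^2 and keeps m'^2. On the numerator z it
      can only decrease, so the S-norm is at most z / m'^2 = N.\<close>
    also have "delete_primes S ((m' * m') * (c * c)) = m' * m'"
      using m' c by (simp add: delete_primes_mult delete_primes_smooth)
    also have "rat_of_nat (delete_primes S (nat z)) / of_nat (m' * m') \<le> of_nat (nat z) / of_nat (m' * m')"
      using delete_primes_le[of "nat z" S] \<open>z > 0\<close> by (intro divide_right_mono) auto
    also have "\<dots> = N"
      unfolding N_eq using \<open>z > 0\<close> by (simp add: power2_eq_square)
    finally show ?thesis
      using \<open>N < 1\<close> by simp
  qed (simp add: S_norm_def)
  moreover have "\<gamma> \<in> S_integers S d"
    unfolding S_integers_def \<gamma>_def using c by blast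
  ultimately show "\<exists>\<gamma>\<in>S_integers S d. S_norm S d (\<xi> - \<gamma>) < 1"
    by blast
qed

lemma S_norm_Euclidean_if_bound:
  assumes "d > 0" "n > 0" "{1..n} \<subseteq> S_smooth S"
    and bound: "4 * d < 3 * (n + 1)\<^sup>2 \<or> d mod 4 = 3 \<and> d < 3 * (n + 1)\<^sup>2"
  shows "S_norm_Euclidean S d"
proof (cases "d mod 4 = 3")
  case True
  then obtain e where e: "d = 4 * e + 3"
    by (metis div_mod_decomp mult.commute)
  have "[- int d = 1] (mod 4)"
    unfolding e cong_def by presburger
  then have gen: "int_gen d = of_rat (1 / 2) + of_rat (1 / 2) * sqrt_neg d"
    by (simp add: int_gen_def of_rat_divide field_simps)
  \<comment> \<open>With d = 4 * e + 3 the norm form is p^2 + p * q + (e + 1) * q^2, which is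
    visibly integral.\<close>
  have "(of_int p + of_int q * (1 / 2))\<^sup>2 + of_nat d * (of_int q * (1 / 2))\<^sup>2 =
      rat_of_int (p\<^sup>2 + p * q + (int e + 1) * q\<^sup>2)" for p q
    unfolding e by (simp add: field_simps power2_eq_square)
  then have int: "(of_int p + of_int q * (1 / 2))\<^sup>2 + of_nat d * (of_int q * (1 / 2))\<^sup>2 \<in> (\<int> :: rat set)"
    for p q by (metis Ints_of_int)
  have "d < 3 * (n + 1)\<^sup>2"
    using bound by auto
  then have "rat_of_nat d < of_nat (3 * (n + 1)\<^sup>2)"
    by (simp only: of_nat_less_iff)
  then have "4 * (of_nat d * (1 / 2)\<^sup>2) < 3 * (rat_of_nat (n + 1))\<^sup>2"
    by (simp add: power_divide)
  then show ?thesis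
    by (intro S_norm_Euclidean_criterion[OF assms(1-3) gen _ int]) auto
next
  case False
  have "int d mod 4 \<noteq> 3"
    using False by presburger
  then have "\<not> [- int d = 1] (mod 4)"
    unfolding cong_def by presburger
  then have gen: "int_gen d = of_rat 0 + of_rat 1 * sqrt_neg d"
    by (simp add: int_gen_def)
  have int: "(of_int p + of_int q * 0)\<^sup>2 + of_nat d * (of_int q * 1)\<^sup>2 \<in> (\<int> :: rat set)" for p q
    by simp
  have "4 * d < 3 * (n + 1)\<^sup>2"
    using bound False by blast
  then have "rat_of_nat (4 * d) < of_nat (3 * (n + 1)\<^sup>2)"
    by (simp only: of_nat_less_iff)
  then have "4 * (of_nat d * 1\<^sup>2) < 3 * (rat_of_nat (n + 1))\<^sup>2"
    by simp
  then show ?thesis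
    by (intro S_norm_Euclidean_criterion[OF assms(1-3) gen _ int]) auto
qed

theorem theorem1:
  fixes d :: nat and S :: "nat set"
  assumes "d > 0" and "squarefree d"
    and "finite S" and "\<forall>p \<in> S. prime p"
    and "S = {} \<and> d \<in> {1, 2, 3, 7, 11} \<or>
         S = {2} \<and> d \<in> {1, 2, 3, 5, 6, 7, 11, 15, 19, 23} \<or>
         S = {2, 3} \<and> d \<in> {1, 2, 3, 5, 6, 7, 10, 11, 13, 14, 15, 17, 19, 23, 31, 35, 39, 43,
            47, 51, 55, 59, 67, 71} \<or>
         S = {2, 3, 5} \<and> d \<in> {1, 2, 3, 5, 6, 7, 10, 11, 13, 14, 15, 17, 19, 21, 22, 23, 26, 29,
            30, 31, 33, 34, 35, 39, 43, 47, 51, 55, 59, 67, 71, 79, 83, 87, 91, 95, 103, 107, 111,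
            115, 119, 123, 127, 131, 139, 143}"
  shows "S_norm_Euclidean S d"
proof -
  have small: "p \<in> {2, 3, 5}" if "prime p" "p \<le> 6" for p :: nat
  proof -
    have "p \<ge> 2" "p > 2 \<Longrightarrow> odd p"
      using that prime_ge_2_nat prime_odd_nat by auto
    then have "p = 2 \<or> p = 3 \<or> p = 5"
      using \<open>p \<le> 6\<close> by presburger
    then show ?thesis
      by simp
  qed
  have smooth: "{1..n} \<subseteq> S_smooth S" if "n \<le> 6" "\<forall>p\<in>{2, 3, 5}. p \<le> n \<longrightarrow> p \<in> S" for n
  proof (rule atLeastAtMost_subset_S_smooth)
    fix p :: nat assume "prime p" "p \<le> n"
    then have "p \<in> {2, 3, 5}"
      using small \<open>n \<le> 6\<close> order.trans by blast
    then show "p \<in> S"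
      using that(2) \<open>p \<le> n\<close> by blast
  qed
  \<comment> \<open>In each case n + 1 is the least prime outside S, namely 2, 3, 5, 7. The limit 3
    * (n + 1)^2 is then 12, 27, 75, 147, applied to d if d mod 4 = 3 and to 4 * d otherwise.\<close>
  show ?thesis
    using assms(5)
  proof (elim disjE conjE, goal_cases)
    case 1
    have "{1..1} \<subseteq> S_smooth S"
      using 1(1) by (intro smooth) simp_all
    moreover have "4 * d < 3 * (1 + 1)\<^sup>2 \<or> d mod 4 = 3 \<and> d < 3 * (1 + 1)\<^sup>2"
      using 1(2) by (elim insertE emptyE) (simp_all add: power2_eq_square)
    ultimately show ?case
      by (intro S_norm_Euclidean_if_bound[OF assms(1), of 1]) simp_all
  next
    case 2
    have "{1..2} \<subseteq> S_smooth S"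
      using 2(1) by (intro smooth) simp_all
    moreover have "4 * d < 3 * (2 + 1)\<^sup>2 \<or> d mod 4 = 3 \<and> d < 3 * (2 + 1)\<^sup>2"
      using 2(2) by (elim insertE emptyE) (simp_all add: power2_eq_square)
    ultimately show ?case
      by (intro S_norm_Euclidean_if_bound[OF assms(1), of 2]) simp_all
  next
    case 3
    have "{1..4} \<subseteq> S_smooth S"
      using 3(1) by (intro smooth) simp_all
    moreover have "4 * d < 3 * (4 + 1)\<^sup>2 \<or> d mod 4 = 3 \<and> d < 3 * (4 + 1)\<^sup>2"
      using 3(2) by (elim insertE emptyE) (simp_all add: power2_eq_square)
    ultimately show ?case
      by (intro S_norm_Euclidean_if_bound[OF assms(1), of 4]) simp_all
  next
    case 4
    have "{1..6} \<subseteq> S_smooth S"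
      using 4(1) by (intro smooth) simp_all
    moreover have "4 * d < 3 * (6 + 1)\<^sup>2 \<or> d mod 4 = 3 \<and> d < 3 * (6 + 1)\<^sup>2"
      using 4(2) by (elim insertE emptyE) (simp_all add: power2_eq_square)
    ultimately show ?case
      by (intro S_norm_Euclidean_if_bound[OF assms(1), of 6]) simp_all
  qed
qed

end
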